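(* Let $L$ be a co-Brouwerian semilattice satisfying the Splitting Axiom. Then for every finite sub-CBS $L_0\subseteq L$ and every signature $(h_1,h_2,g)$ of the second kind in $L_0$, there exists a primitive couple $(x_1,x_2)\in L^2$ of the second kind over $L_0$ inducing this signature.
   Context: A co-Brouwerian semilattice (CBS) is a poset with least element $0$, binary joins $\vee$ and a difference $-$ characterized by $a-b\le c$ iff $a\le b\vee c$. $a\ll b$ means $a\le b$ and $b-a=b$. Splitting Axiom: for all $a,b_1,b_2$ with $b_1\vee b_2\ll a\ne0$ there exist $a_1,a_2\ne0$ with $a-a_1=a_2\ge b_2$, $a-a_2=a_1\ge b_1$, $b_2-a_1=b_2-b_1$, $b_1-a_2=b_1-b_2$. An element $g$ is join-irreducible if for all $n\ge0$, $g\le b_1\vee\dots\vee b_n$ implies $g\le b_i$ for some $i$; in a finite CBS each join-irreducible $g$ has a unique predecessor $g^-$. A signature of the second kind in a finite CBS $L_0$ is a triple $(h_1,h_2,g)$ with $h_1,h_2\in L_0$, $g$ join-irreducible in $L_0$, and $h_1\vee h_2=g^-$. A pair $(x_1,x_2)\in L^2$ is a primitive couple of the second kind over $L_0$ if $x_1,x_2\notin L_0$, $x_1\neq x_2$, and there is a join-irreducible $g$ of $L_0$ with $g-x_1=x_2$, $g-x_2=x_1$, and $a-x_i\in L_0$ ($i=1,2$) for every join-irreducible $a$ of $L_0$ with $a<g$. It induces $(h_1,h_2,g)$ if $g=x_1\vee x_2$ and for every join-irreducible $a$ of $L_0$ and $i=1,2$: $a<x_i$ iff $a\le h_i$. *)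

theory Defs
  imports Main
begin

unbundle lattice_syntax

text \<open>The least element \<open>0\<close> of a co-Brouwerian semilattice is written \<open>\<bottom>\<close>, its join \<open>\<squnion>\<close>.\<close>

class co_brouwerian_semilattice = bounded_semilattice_sup_bot + minus +
  assumes minus_le_iff_le_sup: "a - b \<le> c \<longleftrightarrow> a \<le> b \<squnion> c"

definition strongly_below :: "'a::co_brouwerian_semilattice \<Rightarrow> 'a \<Rightarrow> bool"  (infix "\<lless>" 50)
  where "a \<lless> b \<longleftrightarrow> a \<le> b \<and> b - a = b"

definition splitting_axiom :: "'a::co_brouwerian_semilattice itself \<Rightarrow> bool"
  where "splitting_axiom (_ :: 'a itself) \<longleftrightarrow>
    (\<forall>a b\<^sub>1 b\<^sub>2 :: 'a. b\<^sub>1 \<squnion> b\<^sub>2 \<lless> a \<and> a \<noteq> \<bottom> \<longrightarrow>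
      (\<exists>a\<^sub>1 a\<^sub>2. a\<^sub>1 \<noteq> \<bottom> \<and> a\<^sub>2 \<noteq> \<bottom> \<and>
        a - a\<^sub>1 = a\<^sub>2 \<and> a\<^sub>2 \<ge> b\<^sub>2 \<and>
        a - a\<^sub>2 = a\<^sub>1 \<and> a\<^sub>1 \<ge> b\<^sub>1 \<and>
        b\<^sub>2 - a\<^sub>1 = b\<^sub>2 - b\<^sub>1 \<and>
        b\<^sub>1 - a\<^sub>2 = b\<^sub>1 - b\<^sub>2))"

definition sub_cbs :: "'a::co_brouwerian_semilattice set \<Rightarrow> bool"
  where "sub_cbs L\<^sub>0 \<longleftrightarrow>
    \<bottom> \<in> L\<^sub>0 \<and> (\<forall>a\<in>L\<^sub>0. \<forall>b\<in>L\<^sub>0. a \<squnion> b \<in> L\<^sub>0 \<and> a - b \<in> L\<^sub>0)"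

text \<open>The finite join \<open>b\<^sub>1 \<squnion> \<dots> \<squnion> b\<^sub>n\<close> is that of the list \<open>[b\<^sub>1, \<dots>, b\<^sub>n]\<close>; the empty list is
  the case \<open>n = 0\<close>, which excludes \<open>g = \<bottom>\<close>.\<close>

definition join_irreducible :: "'a::co_brouwerian_semilattice set \<Rightarrow> 'a \<Rightarrow> bool"
  where "join_irreducible L\<^sub>0 g \<longleftrightarrow> g \<in> L\<^sub>0 \<and>
    (\<forall>bs. set bs \<subseteq> L\<^sub>0 \<longrightarrow> g \<le> foldr (\<squnion>) bs \<bottom> \<longrightarrow> (\<exists>b\<in>set bs. g \<le> b))"

definition is_predecessor :: "'a::co_brouwerian_semilattice set \<Rightarrow> 'a \<Rightarrow> 'a \<Rightarrow> bool"
  where "is_predecessor L\<^sub>0 p g \<longleftrightarrow> p \<in> L\<^sub>0 \<and> p < g \<and> \<not> (\<exists>c\<in>L\<^sub>0. p < c \<and> c < g)"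

text \<open>The element \<open>g\<^sup>-\<close>; see \<open>ex1_predecessor\<close> below for its existence and uniqueness.\<close>

definition predecessor :: "'a::co_brouwerian_semilattice set \<Rightarrow> 'a \<Rightarrow> 'a"
  where "predecessor L\<^sub>0 g = (THE p. is_predecessor L\<^sub>0 p g)"

definition second_kind_signature ::
    "'a::co_brouwerian_semilattice set \<Rightarrow> 'a \<Rightarrow> 'a \<Rightarrow> 'a \<Rightarrow> bool"
  where "second_kind_signature L\<^sub>0 h\<^sub>1 h\<^sub>2 g \<longleftrightarrow>
    h\<^sub>1 \<in> L\<^sub>0 \<and> h\<^sub>2 \<in> L\<^sub>0 \<and> join_irreducible L\<^sub>0 g \<and> h\<^sub>1 \<squnion> h\<^sub>2 = predecessor L\<^sub>0 g"

definition second_kind_primitive_couple ::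
    "'a::co_brouwerian_semilattice set \<Rightarrow> 'a \<Rightarrow> 'a \<Rightarrow> bool"
  where "second_kind_primitive_couple L\<^sub>0 x\<^sub>1 x\<^sub>2 \<longleftrightarrow>
    x\<^sub>1 \<notin> L\<^sub>0 \<and> x\<^sub>2 \<notin> L\<^sub>0 \<and> x\<^sub>1 \<noteq> x\<^sub>2 \<and>
    (\<exists>g. join_irreducible L\<^sub>0 g \<and> g - x\<^sub>1 = x\<^sub>2 \<and> g - x\<^sub>2 = x\<^sub>1 \<and>
      (\<forall>a. join_irreducible L\<^sub>0 a \<and> a < g \<longrightarrow> a - x\<^sub>1 \<in> L\<^sub>0 \<and> a - x\<^sub>2 \<in> L\<^sub>0))"

definition induces_second_kind_signature ::
    "'a::co_brouwerian_semilattice set \<Rightarrow> 'a \<Rightarrow> 'a \<Rightarrow> 'a \<Rightarrow> 'a \<Rightarrow> 'a \<Rightarrow> bool"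
  where "induces_second_kind_signature L\<^sub>0 x\<^sub>1 x\<^sub>2 h\<^sub>1 h\<^sub>2 g \<longleftrightarrow>
    g = x\<^sub>1 \<squnion> x\<^sub>2 \<and>
    (\<forall>a. join_irreducible L\<^sub>0 a \<longrightarrow> (a < x\<^sub>1 \<longleftrightarrow> a \<le> h\<^sub>1) \<and> (a < x\<^sub>2 \<longleftrightarrow> a \<le> h\<^sub>2))"

lemma foldr_sup_in_sub_cbs:
  fixes L\<^sub>0 :: "'a::co_brouwerian_semilattice set"
  assumes "sub_cbs L\<^sub>0" "set bs \<subseteq> L\<^sub>0"
  shows "foldr (\<squnion>) bs \<bottom> \<in> L\<^sub>0"
  using assms by (induction bs) (auto simp: sub_cbs_def)

lemma le_foldr_sup:
  fixes b :: "'a::co_brouwerian_semilattice"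
  assumes "b \<in> set bs"
  shows "b \<le> foldr (\<squnion>) bs \<bottom>"
  using assms by (induction bs) (auto simp: le_supI1 le_supI2)

lemma foldr_sup_le:
  fixes g :: "'a::co_brouwerian_semilattice"
  assumes "\<forall>b\<in>set bs. b \<le> g"
  shows "foldr (\<squnion>) bs \<bottom> \<le> g"
  using assms by (induction bs) auto

lemma ex1_predecessor:
  fixes L\<^sub>0 :: "'a::co_brouwerian_semilattice set"
  assumes "finite L\<^sub>0" "sub_cbs L\<^sub>0" "join_irreducible L\<^sub>0 g"
  shows "\<exists>!p. is_predecessor L\<^sub>0 p g"
proof -
  obtain bs where bs: "set bs = {c \<in> L\<^sub>0. c < g}"
    using finite_list[OF finite_subset[OF _ assms(1), of "{c \<in> L\<^sub>0. c < g}"]] by blast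
  define p where "p = foldr (\<squnion>) bs \<bottom>"
  have p_in: "p \<in> L\<^sub>0"
    unfolding p_def by (rule foldr_sup_in_sub_cbs[OF assms(2)]) (simp add: bs)
  have "\<not> g \<le> p"
  proof
    assume "g \<le> p"
    moreover have "set bs \<subseteq> L\<^sub>0" using bs by blast
    ultimately obtain b where "b \<in> set bs" "g \<le> b"
      using assms(3) unfolding join_irreducible_def p_def by blast
    then show False using bs by (simp add: less_le_not_le)
  qed
  moreover have "p \<le> g"
    unfolding p_def by (rule foldr_sup_le) (simp add: bs less_imp_le)
  ultimately have p_less: "p < g" by (simp add: less_le_not_le)
  have greatest: "c \<le> p" if "c \<in> L\<^sub>0" "c < g" for c
    unfolding p_def by (rule le_foldr_sup) (simp add: bs that)
  show ?thesis
  proof (rule ex1I[of _ p])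
    show "is_predecessor L\<^sub>0 p g"
      unfolding is_predecessor_def
    proof (intro conjI notI)
      assume "\<exists>c\<in>L\<^sub>0. p < c \<and> c < g"
      then obtain c where c: "c \<in> L\<^sub>0" "p < c" "c < g" by blast
      with greatest[OF c(1,3)] show False by (simp add: less_le_not_le)
    qed (fact p_in p_less)+
  next
    fix q assume "is_predecessor L\<^sub>0 q g"
    then have q: "q \<in> L\<^sub>0" "q < g" "\<not> (q < p \<and> p < g)"
      using p_in unfolding is_predecessor_def by blast+
    then have "\<not> q < p" using p_less by blast
    with greatest[OF q(1,2)] show "q = p" by (simp add: order_le_less)
  qed
qed

unbundle no lattice_syntax

end

(* Let k be the predecessor of g. The splitting axiom for g and (h1, h2) gives g = u1 v u2 with the
   right differences only for h1 and h2 themselves, not for the join-irreducibles strictly below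
   them. The remedy is to split further.
   Let A1 (A2) be the join-irreducibles below h1 but not h2 (below h2 but not h1).
   Splitting u1 repeatedly yields a nonzero p1 >= h1 with a - p1 = a for all a in A2, and likewise
   p2 from u2. What was cut off, r, need not lie above anything, so it can be split along all pairs
   in A1 x A2 into s1 v s2 with a - s1 = a for a in A2 and c - s2 = c for c in A1.
   Then p1 v s1 and p2 v s2 are, up to regularization, the required couple. *)

theory Submission
  imports Defs
begin

unbundle lattice_syntax

section \<open>Differences\<close>

context co_brouwerian_semilattice
begin

lemma le_sup_minus: "a \<le> b \<squnion> (a - b)"
  using minus_le_iff_le_sup by blast

lemma minus_le_self: "a - b \<le> a"
  by (simp add: minus_le_iff_le_sup)

lemma minus_mono: "a \<le> b \<Longrightarrow> d \<le> c \<Longrightarrow> a - c \<le> b - d"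
  using order_trans [OF _ order_trans [OF le_sup_minus sup_mono [OF _ order_refl]]]
  unfolding minus_le_iff_le_sup by blast

lemma minus_minus_sup: "a - b - c = a - (b \<squnion> c)"
proof (rule order.antisym)
  show "a - b - c \<le> a - (b \<squnion> c)"
    unfolding minus_le_iff_le_sup using le_sup_minus [of a "b \<squnion> c"] by (simp add: sup_assoc)
  have "a \<le> b \<squnion> (c \<squnion> (a - b - c))"
    using le_sup_minus minus_le_iff_le_sup by blast
  then show "a - (b \<squnion> c) \<le> a - b - c"
    by (simp add: minus_le_iff_le_sup sup_assoc)
qed

lemma minus_minus_commute: "a - b - c = a - c - b"
  by (simp add: minus_minus_sup sup_commute)

lemma sup_minus_distrib: "(a \<squnion> b) - c = (a - c) \<squnion> (b - c)"
proof (rule order.antisym)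
  show "(a \<squnion> b) - c \<le> (a - c) \<squnion> (b - c)"
    using sup_mono [OF le_sup_minus [of a c] le_sup_minus [of b c]]
    by (simp add: minus_le_iff_le_sup ac_simps)
qed (simp add: minus_mono)

lemma minus_bot [simp]: "a - \<bottom> = a"
  using le_sup_minus [of a \<bottom>] minus_le_self [of a \<bottom>] by (simp add: order.antisym)

lemma minus_eq_bot_iff: "a - b = \<bottom> \<longleftrightarrow> a \<le> b"
  using minus_le_iff_le_sup [of a b \<bottom>] by (auto intro: bot.extremum_uniqueI)

text \<open>Identities \<open>a - w = a\<close> are the invariants of the whole construction. As
  they survive shrinking \<open>w\<close>, a piece can be split again without losing those already
  achieved.\<close>

lemma minus_eq_self_mono: "a - w = a \<Longrightarrow> v \<le> w \<Longrightarrow> a - v = a"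
  using minus_mono [of a a v w] by (simp add: order.antisym minus_le_self)

lemma minus_eq_self_sup: "a - v = a \<Longrightarrow> a - w = a \<Longrightarrow> a - (v \<squnion> w) = a"
  by (simp flip: minus_minus_sup)

text \<open>What remains of \<open>a\<close> after a subtraction keeps its relation to
  \<open>k\<close>, so it can be split in turn with the same bound.\<close>

lemma minus_eq_self_minus: "a - k = a \<Longrightarrow> a - b - k = a - b"
  by (simp only: minus_minus_commute [of a b k])

text \<open>\<open>a - (a - w)\<close> stands in for the possibly missing meet of \<open>a\<close> and \<open>w\<close>.\<close>

lemma minus_eq_self_by_part:
  assumes part: "(a - (a - w)) - z = (a - (a - w)) - b"
    and "z \<le> w" and "a - b = a"
  shows "a - z = a"
proof (rule order.antisym [OF minus_le_self])
  have "a - (a - w) = (a - (a - w)) - b"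
    by (rule minus_eq_self_minus [OF assms(3), symmetric])
  also have "\<dots> \<le> a - z"
    unfolding part [symmetric] by (rule minus_mono [OF minus_le_self order_refl])
  finally have "a - (a - w) \<le> a - z" .
  moreover have "a - w \<le> a - z"
    using \<open>z \<le> w\<close> by (simp add: minus_mono)
  \<comment> \<open>\<open>a\<close> lies below the join of \<open>a - w\<close> and
    \<open>a - (a - w)\<close>, and both are now bounded by \<open>a - z\<close>.\<close>
  ultimately show "a \<le> a - z"
    using le_sup_minus [of a "a - w"] by (meson le_supI order_trans)
qed

end

section \<open>Repeated splitting\<close>

text \<open>A common bound \<open>k\<close> with \<open>a - k = a\<close> yields the premise of the
  axiom by monotonicity. One \<open>k\<close>, later the predecessor of \<open>g\<close>, then
  serves every splitting.\<close>

lemma splitting_axiomE: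
  fixes a :: "'a::co_brouwerian_semilattice"
  assumes "splitting_axiom TYPE('a)"
    and "b\<^sub>1 \<le> k" "b\<^sub>2 \<le> k" "b\<^sub>1 \<le> a" "b\<^sub>2 \<le> a" "a - k = a" "a \<noteq> \<bottom>"
  obtains a\<^sub>1 a\<^sub>2 where "a\<^sub>1 \<noteq> \<bottom>" "a\<^sub>2 \<noteq> \<bottom>" "a - a\<^sub>1 = a\<^sub>2" "a - a\<^sub>2 = a\<^sub>1"
    "b\<^sub>1 \<le> a\<^sub>1" "b\<^sub>2 \<le> a\<^sub>2" "b\<^sub>2 - a\<^sub>1 = b\<^sub>2 - b\<^sub>1" "b\<^sub>1 - a\<^sub>2 = b\<^sub>1 - b\<^sub>2"
proof -
  have "b\<^sub>1 \<squnion> b\<^sub>2 \<lless> a"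
    unfolding strongly_below_def
    using assms minus_eq_self_mono [of a k "b\<^sub>1 \<squnion> b\<^sub>2"] by simp
  with assms(1) \<open>a \<noteq> \<bottom>\<close> show thesis
    unfolding splitting_axiom_def using that by blast
qed

text \<open>Induction on \<open>A\<close>: the current \<open>p\<close> is split with
  \<open>h\<close> and the part of the new \<open>a\<close> inside \<open>p\<close> as lower bounds.
  Because \<open>a - h = a\<close>, the difference equation of the axiom makes subtracting the piece
  above \<open>h\<close> leave \<open>a\<close> unchanged. That piece is nonzero and replaces
  \<open>p\<close>; the other one is added to \<open>r\<close>.\<close>

lemma split_off_avoiding:
  fixes u :: "'a::co_brouwerian_semilattice"
  assumes split: "splitting_axiom TYPE('a)"
    and "finite A" and A: "\<And>a. a \<in> A \<Longrightarrow> a \<le> k \<and> a - h = a"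
    and h: "h \<le> k" "h \<le> u" and u: "u - k = u" "u \<noteq> \<bottom>"
  shows "\<exists>p r. p \<noteq> \<bottom> \<and> h \<le> p \<and> u - r = p \<and> r \<le> u \<and> r - k = r \<and> (\<forall>a\<in>A. a - p = a)"
  using \<open>finite A\<close> A
proof (induction rule: finite_induct)
  case empty
  show ?case
    by (rule exI [of _ u], rule exI [of _ \<bottom>]) (use h u in \<open>simp add: minus_eq_bot_iff\<close>)
next
  case (insert a A)
  then obtain p r where p: "p \<noteq> \<bottom>" "h \<le> p" "u - r = p"
    and r: "r \<le> u" "r - k = r" and avoid: "\<And>b. b \<in> A \<Longrightarrow> b - p = b"
    by auto
  have a: "a \<le> k" "a - h = a"
    using insert.prems by auto
  have pk: "p - k = p"
    using minus_eq_self_minus [OF u(1), of r] p(3) by simp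
  have "a - (a - p) \<le> k"
    using minus_le_self a(1) by (rule order_trans)
  moreover have "a - (a - p) \<le> p"
    by (metis le_sup_minus minus_le_iff_le_sup sup_commute)
  ultimately obtain z\<^sub>1 z\<^sub>2 where z: "z\<^sub>1 \<noteq> \<bottom>" "p - z\<^sub>1 = z\<^sub>2" "p - z\<^sub>2 = z\<^sub>1" "h \<le> z\<^sub>1"
    and part: "(a - (a - p)) - z\<^sub>1 = (a - (a - p)) - h"
    using splitting_axiomE [OF split h(1) _ p(2) _ pk p(1)] by metis
  have z1: "z\<^sub>1 \<le> p" and z2: "z\<^sub>2 \<le> p"
    using z minus_le_self by metis+
  have "a - z\<^sub>1 = a"
    using minus_eq_self_by_part [OF part z1 a(2)] .
  moreover have "b - z\<^sub>1 = b" if "b \<in> A" for b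
    using minus_eq_self_mono [OF avoid [OF that] z1] .
  moreover have "u - (r \<squnion> z\<^sub>2) = z\<^sub>1"
    by (simp add: p(3) z(3) flip: minus_minus_sup)
  moreover have "r \<squnion> z\<^sub>2 \<le> u"
    using r(1) z2 p(3) minus_le_self [of u r] by auto
  moreover have "(r \<squnion> z\<^sub>2) - k = r \<squnion> z\<^sub>2"
    using minus_eq_self_minus [OF pk, of z\<^sub>1] r(2) z(2) by (simp add: sup_minus_distrib)
  ultimately show ?case
    using z by blast
qed

text \<open>The axiom splits \<open>w\<close> with the parts of \<open>c\<close> and
  \<open>a\<close> inside \<open>w\<close> as lower bounds of \<open>s\<^sub>1\<close> and
  \<open>s\<^sub>2\<close>. On the part of \<open>a\<close>, subtracting \<open>s\<^sub>1\<close>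
  acts like subtracting the part of \<open>c\<close>, which changes nothing since
  \<open>a - c = a\<close>; the other side is symmetric.\<close>

lemma separate_pair:
  fixes w :: "'a::co_brouwerian_semilattice"
  assumes split: "splitting_axiom TYPE('a)"
    and "a \<le> k" "c \<le> k" "a - c = a" "c - a = c" "w - k = w"
  shows "\<exists>s\<^sub>1 s\<^sub>2. s\<^sub>1 \<squnion> s\<^sub>2 = w \<and> s\<^sub>1 - k = s\<^sub>1 \<and> s\<^sub>2 - k = s\<^sub>2 \<and> a - s\<^sub>1 = a \<and> c - s\<^sub>2 = c"
\<comment> \<open>The axiom splits only nonzero elements, whereas the \<open>w\<close> to be
  distributed may be \<open>\<bottom>\<close>.\<close>
proof (cases "w = \<bottom>")
  case True
  then show ?thesis
    using \<open>w - k = w\<close> by (intro exI [of _ \<bottom>]) simp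
next
  case False
  have part_le: "x - (x - w) \<le> w" "x - (x - w) \<le> x" for x
    by (metis le_sup_minus minus_le_iff_le_sup sup_commute) (rule minus_le_self)
  obtain s\<^sub>1 s\<^sub>2 where s: "w - s\<^sub>1 = s\<^sub>2" "w - s\<^sub>2 = s\<^sub>1"
    and parts: "(a - (a - w)) - s\<^sub>1 = (a - (a - w)) - (c - (c - w))"
      "(c - (c - w)) - s\<^sub>2 = (c - (c - w)) - (a - (a - w))"
    using splitting_axiomE [OF split order_trans [OF part_le(2) \<open>c \<le> k\<close>]
        order_trans [OF part_le(2) \<open>a \<le> k\<close>] part_le(1) part_le(1) \<open>w - k = w\<close> False]
    by metis
  have le: "s\<^sub>1 \<le> w" "s\<^sub>2 \<le> w"
    using s minus_le_self by metis+
  have "s\<^sub>1 \<squnion> s\<^sub>2 = w"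
    using le le_sup_minus [of w s\<^sub>1] s(1) by (simp add: order.antisym)
  moreover have "s\<^sub>1 - k = s\<^sub>1" "s\<^sub>2 - k = s\<^sub>2"
    using s minus_eq_self_minus [OF \<open>w - k = w\<close>] by metis+
  moreover have "a - s\<^sub>1 = a"
    using minus_eq_self_by_part [OF parts(1) le(1)]
      minus_eq_self_mono [OF \<open>a - c = a\<close> part_le(2)] .
  moreover have "c - s\<^sub>2 = c"
    using minus_eq_self_by_part [OF parts(2) le(2)]
      minus_eq_self_mono [OF \<open>c - a = c\<close> part_le(2)] .
  ultimately show ?thesis
    by blast
qed

text \<open>Induction on \<open>A\<close>, splitting \<open>s\<^sub>1\<close> against each new
  \<open>a\<close>. The first piece only shrinks, which preserves its earlier identities; the second
  only gains elements whose subtraction leaves \<open>c\<close> unchanged.\<close>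

lemma separate_one:
  fixes w :: "'a::co_brouwerian_semilattice"
  assumes split: "splitting_axiom TYPE('a)"
    and "finite A" and A: "\<And>a. a \<in> A \<Longrightarrow> a \<le> k \<and> a - c = a \<and> c - a = c"
    and "c \<le> k" and w: "w - k = w"
  shows "\<exists>s\<^sub>1 s\<^sub>2. s\<^sub>1 \<squnion> s\<^sub>2 = w \<and> s\<^sub>1 - k = s\<^sub>1 \<and> s\<^sub>2 - k = s\<^sub>2 \<and> (\<forall>a\<in>A. a - s\<^sub>1 = a) \<and> c - s\<^sub>2 = c"
  using \<open>finite A\<close> A
proof (induction rule: finite_induct)
  case empty
  show ?case
    by (rule exI [of _ w], rule exI [of _ \<bottom>]) (simp add: w minus_eq_bot_iff)
next
  case (insert a A)
  then obtain s\<^sub>1 s\<^sub>2 where s: "s\<^sub>1 \<squnion> s\<^sub>2 = w" "s\<^sub>1 - k = s\<^sub>1" "s\<^sub>2 - k = s\<^sub>2"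
    "\<And>b. b \<in> A \<Longrightarrow> b - s\<^sub>1 = b" "c - s\<^sub>2 = c"
    by auto
  obtain t\<^sub>1 t\<^sub>2 where t: "t\<^sub>1 \<squnion> t\<^sub>2 = s\<^sub>1" "t\<^sub>1 - k = t\<^sub>1" "t\<^sub>2 - k = t\<^sub>2" "a - t\<^sub>1 = a" "c - t\<^sub>2 = c"
    using separate_pair [OF split _ \<open>c \<le> k\<close> _ _ s(2), of a] insert.prems by auto
  have "b - t\<^sub>1 = b" if "b \<in> A" for b
    using minus_eq_self_mono [OF s(4) [OF that]] t(1) by auto
  moreover have "t\<^sub>1 \<squnion> (t\<^sub>2 \<squnion> s\<^sub>2) = w"
    using s(1) t(1) by (simp flip: sup_assoc)
  moreover have "(t\<^sub>2 \<squnion> s\<^sub>2) - k = t\<^sub>2 \<squnion> s\<^sub>2"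
    using s(3) t(3) by (simp add: sup_minus_distrib)
  moreover have "c - (t\<^sub>2 \<squnion> s\<^sub>2) = c"
    using t(5) s(5) by (rule minus_eq_self_sup)
  ultimately show ?case
    using t by blast
qed

text \<open>The same induction with the roles exchanged: each new \<open>c\<close> splits the second
  piece, which starts as all of \<open>w\<close>. Only this piece is split further, so only its
  relation to \<open>k\<close> is carried along.\<close>

lemma separate:
  fixes w :: "'a::co_brouwerian_semilattice"
  assumes split: "splitting_axiom TYPE('a)"
    and "finite A" "finite C"
    and A: "\<And>a. a \<in> A \<Longrightarrow> a \<le> k" and C: "\<And>c. c \<in> C \<Longrightarrow> c \<le> k"
    and AC: "\<And>a c. a \<in> A \<Longrightarrow> c \<in> C \<Longrightarrow> a - c = a \<and> c - a = c"
    and w: "w - k = w"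
  shows "\<exists>s\<^sub>1 s\<^sub>2. s\<^sub>1 \<squnion> s\<^sub>2 = w \<and> s\<^sub>2 - k = s\<^sub>2 \<and> (\<forall>a\<in>A. a - s\<^sub>1 = a) \<and> (\<forall>c\<in>C. c - s\<^sub>2 = c)"
  using \<open>finite C\<close> C AC
proof (induction rule: finite_induct)
  case empty
  show ?case
    by (rule exI [of _ \<bottom>], rule exI [of _ w]) (simp add: w)
next
  case (insert c C)
  then obtain s\<^sub>1 s\<^sub>2 where s: "s\<^sub>1 \<squnion> s\<^sub>2 = w" "s\<^sub>2 - k = s\<^sub>2"
    "\<And>a. a \<in> A \<Longrightarrow> a - s\<^sub>1 = a" "\<And>c. c \<in> C \<Longrightarrow> c - s\<^sub>2 = c"
    by auto
  obtain t\<^sub>1 t\<^sub>2 where t: "t\<^sub>1 \<squnion> t\<^sub>2 = s\<^sub>2" "t\<^sub>2 - k = t\<^sub>2"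
    "\<And>a. a \<in> A \<Longrightarrow> a - t\<^sub>1 = a" "c - t\<^sub>2 = c"
    using separate_one [OF split \<open>finite A\<close> _ _ s(2), of c] A insert.prems by auto
  have "b - t\<^sub>2 = b" if "b \<in> C" for b
    using minus_eq_self_mono [OF s(4) [OF that]] t(1) by auto
  moreover have "s\<^sub>1 \<squnion> t\<^sub>1 \<squnion> t\<^sub>2 = w"
    using s(1) t(1) by (simp add: sup_assoc)
  moreover have "a - (s\<^sub>1 \<squnion> t\<^sub>1) = a" if "a \<in> A" for a
    using s(3) [OF that] t(3) [OF that] by (rule minus_eq_self_sup)
  ultimately show ?case
    using t by blast
qed

section \<open>Join-irreducible elements\<close>

lemma join_irreducible_nonbot:
  assumes "join_irreducible L g"
  shows "g \<noteq> \<bottom>"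
proof
  assume "g = \<bottom>"
  with assms show False
    unfolding join_irreducible_def by (auto dest: spec [of _ "[]"])
qed

lemma join_irreducible_le_sup:
  assumes "join_irreducible L g" "a \<in> L" "b \<in> L" "g \<le> a \<squnion> b"
  shows "g \<le> a \<or> g \<le> b"
  using assms unfolding join_irreducible_def by (auto dest: spec [of _ "[a, b]"])

text \<open>Apply irreducibility to \<open>g \<le> a \<squnion> (g - a)\<close>. This turns failures
  of the order within \<open>L\<close> into the difference identities that splitting
  requires.\<close>

lemma join_irreducible_minus:
  assumes "join_irreducible L g" "sub_cbs L" "a \<in> L" "\<not> g \<le> a"
  shows "g - a = g"
proof (rule order.antisym [OF minus_le_self])
  have "g - a \<in> L"
    using assms unfolding join_irreducible_def sub_cbs_def by blast
  then show "g \<le> g - a"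
    using join_irreducible_le_sup [OF assms(1,3) _ le_sup_minus] assms(4) by blast
qed

lemma predecessor_properties:
  assumes "finite L" "sub_cbs L" and g: "join_irreducible L g"
  shows "predecessor L g \<in> L" "predecessor L g < g"
    and "c \<in> L \<Longrightarrow> c < g \<Longrightarrow> c \<le> predecessor L g"
proof -
  let ?p = "predecessor L g"
  have p: "is_predecessor L ?p g"
    unfolding predecessor_def by (rule theI' [OF ex1_predecessor [OF assms]])
  then show mem: "?p \<in> L" and less: "?p < g"
    by (auto simp: is_predecessor_def)
  show "c \<le> ?p" if "c \<in> L" "c < g"
  proof -
    \<comment> \<open>Irreducibility keeps the join of two elements strictly below \<open>g\<close>
      strictly below \<open>g\<close>, so it cannot properly exceed \<open>?p\<close>.\<close>
    have "\<not> g \<le> ?p \<squnion> c"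
      using join_irreducible_le_sup [OF g mem \<open>c \<in> L\<close>] less \<open>c < g\<close> by auto
    then have "?p \<squnion> c < g"
      using less \<open>c < g\<close> by (auto simp: less_le_not_le)
    moreover have "?p \<squnion> c \<in> L"
      using mem \<open>c \<in> L\<close> \<open>sub_cbs L\<close> by (simp add: sub_cbs_def)
    ultimately have "\<not> ?p < ?p \<squnion> c"
      using p unfolding is_predecessor_def by blast
    then show ?thesis
      by (metis sup.cobounded1 sup.cobounded2 order_le_less)
  qed
qed

section \<open>Primitive couples\<close>

theorem theorem4p6:
  fixes L\<^sub>0 :: "'a::co_brouwerian_semilattice set"
    and h\<^sub>1 h\<^sub>2 g :: 'a
  assumes "splitting_axiom TYPE('a)"
    and "finite L\<^sub>0" and "sub_cbs L\<^sub>0"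
    and "second_kind_signature L\<^sub>0 h\<^sub>1 h\<^sub>2 g"
  shows "\<exists>x\<^sub>1 x\<^sub>2. second_kind_primitive_couple L\<^sub>0 x\<^sub>1 x\<^sub>2 \<and>
    induces_second_kind_signature L\<^sub>0 x\<^sub>1 x\<^sub>2 h\<^sub>1 h\<^sub>2 g"
proof -
  note split = assms(1)
  define k where "k = predecessor L\<^sub>0 g"
  have h: "h\<^sub>1 \<in> L\<^sub>0" "h\<^sub>2 \<in> L\<^sub>0" "h\<^sub>1 \<squnion> h\<^sub>2 = k" and g: "join_irreducible L\<^sub>0 g"
    using assms(4) by (auto simp: second_kind_signature_def k_def)
  have k: "k \<in> L\<^sub>0" "k < g" "\<And>c. c \<in> L\<^sub>0 \<Longrightarrow> c < g \<Longrightarrow> c \<le> k"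
    using predecessor_properties [OF assms(2,3) g] by (auto simp: k_def)
  have hk: "h\<^sub>1 \<le> k" "h\<^sub>2 \<le> k"
    using h(3) by auto
  have hg: "h\<^sub>1 \<le> g" "h\<^sub>2 \<le> g"
    using hk k(2) by auto
  have gk: "g - k = g"
    using join_irreducible_minus [OF g assms(3) k(1)] k(2) by (simp add: less_le_not_le)
  note diff = join_irreducible_minus [OF _ assms(3)]

  define A\<^sub>1 where "A\<^sub>1 = {a. join_irreducible L\<^sub>0 a \<and> a \<le> h\<^sub>1 \<and> \<not> a \<le> h\<^sub>2}"
  define A\<^sub>2 where "A\<^sub>2 = {a. join_irreducible L\<^sub>0 a \<and> a \<le> h\<^sub>2 \<and> \<not> a \<le> h\<^sub>1}"
  have sub: "A\<^sub>1 \<subseteq> L\<^sub>0" "A\<^sub>2 \<subseteq> L\<^sub>0"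
    by (auto simp: A\<^sub>1_def A\<^sub>2_def join_irreducible_def)
  have fin: "finite A\<^sub>1" "finite A\<^sub>2"
    using sub assms(2) by (auto intro: finite_subset)
  have A1: "a \<le> k \<and> a - h\<^sub>2 = a" if "a \<in> A\<^sub>1" for a
    using that hk(1) diff [OF _ h(2)] by (auto simp: A\<^sub>1_def)
  have A2: "a \<le> k \<and> a - h\<^sub>1 = a" if "a \<in> A\<^sub>2" for a
    using that hk(2) diff [OF _ h(1)] by (auto simp: A\<^sub>2_def)
  have A12: "a - c = a \<and> c - a = c" if "a \<in> A\<^sub>2" "c \<in> A\<^sub>1" for a c
  proof -
    \<comment> \<open>Comparability would place \<open>a\<close> below \<open>h\<^sub>1\<close> or
      \<open>c\<close> below \<open>h\<^sub>2\<close>.\<close>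
    have "\<not> a \<le> c" "\<not> c \<le> a"
      using that by (auto simp: A\<^sub>1_def A\<^sub>2_def dest: order_trans)
    moreover have "a \<in> L\<^sub>0" "c \<in> L\<^sub>0"
      using that sub by auto
    ultimately show ?thesis
      using that diff by (auto simp: A\<^sub>1_def A\<^sub>2_def)
  qed

  obtain u\<^sub>1 u\<^sub>2 where u: "u\<^sub>1 \<noteq> \<bottom>" "u\<^sub>2 \<noteq> \<bottom>" "g - u\<^sub>1 = u\<^sub>2" "g - u\<^sub>2 = u\<^sub>1" "h\<^sub>1 \<le> u\<^sub>1" "h\<^sub>2 \<le> u\<^sub>2"
    using splitting_axiomE [OF split hk hg gk join_irreducible_nonbot [OF g]] by metis
  have uk: "u\<^sub>1 - k = u\<^sub>1" "u\<^sub>2 - k = u\<^sub>2"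
    using minus_eq_self_minus [OF gk] u(3,4) by metis+
  obtain p\<^sub>1 r\<^sub>1 where p1: "p\<^sub>1 \<noteq> \<bottom>" "h\<^sub>1 \<le> p\<^sub>1" "u\<^sub>1 - r\<^sub>1 = p\<^sub>1" "\<And>a. a \<in> A\<^sub>2 \<Longrightarrow> a - p\<^sub>1 = a"
    and r1: "r\<^sub>1 \<le> u\<^sub>1" "r\<^sub>1 - k = r\<^sub>1"
    using split_off_avoiding [OF split fin(2) A2 hk(1) u(5) uk(1) u(1)] by auto
  obtain p\<^sub>2 r\<^sub>2 where p2: "p\<^sub>2 \<noteq> \<bottom>" "h\<^sub>2 \<le> p\<^sub>2" "u\<^sub>2 - r\<^sub>2 = p\<^sub>2" "\<And>a. a \<in> A\<^sub>1 \<Longrightarrow> a - p\<^sub>2 = a"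
    and r2: "r\<^sub>2 \<le> u\<^sub>2" "r\<^sub>2 - k = r\<^sub>2"
    using split_off_avoiding [OF split fin(1) A1 hk(2) u(6) uk(2) u(2)] by auto
  have rk: "(r\<^sub>1 \<squnion> r\<^sub>2) - k = r\<^sub>1 \<squnion> r\<^sub>2"
    using r1 r2 by (simp add: sup_minus_distrib)
  obtain s\<^sub>1 s\<^sub>2 where s: "s\<^sub>1 \<squnion> s\<^sub>2 = r\<^sub>1 \<squnion> r\<^sub>2"
    "\<And>a. a \<in> A\<^sub>2 \<Longrightarrow> a - s\<^sub>1 = a" "\<And>a. a \<in> A\<^sub>1 \<Longrightarrow> a - s\<^sub>2 = a"
    using separate [OF split fin(2,1) _ _ A12 rk] A1 A2 by metis

  \<comment> \<open>These two elements cover \<open>g\<close> and have the required avoidance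
    identities; that each is the difference of \<open>g\<close> and the other is not yet
    ensured.\<close>
  define y\<^sub>1 where "y\<^sub>1 = p\<^sub>1 \<squnion> s\<^sub>1"
  define y\<^sub>2 where "y\<^sub>2 = p\<^sub>2 \<squnion> s\<^sub>2"
  have y1: "a - y\<^sub>1 = a" if "a \<in> A\<^sub>2" for a
    unfolding y\<^sub>1_def using p1(4) [OF that] s(2) [OF that] by (rule minus_eq_self_sup)
  have y2: "a - y\<^sub>2 = a" if "a \<in> A\<^sub>1" for a
    unfolding y\<^sub>2_def using p2(4) [OF that] s(3) [OF that] by (rule minus_eq_self_sup)
  have sle: "s\<^sub>1 \<le> r\<^sub>1 \<squnion> r\<^sub>2" "s\<^sub>2 \<le> r\<^sub>1 \<squnion> r\<^sub>2"
    using s(1) by (metis sup.cobounded1) (metis s(1) sup.cobounded2)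
  have ple: "p\<^sub>1 \<le> u\<^sub>1" "p\<^sub>2 \<le> u\<^sub>2"
    using p1(3) p2(3) minus_le_self by metis+
  have gy: "g \<le> y\<^sub>1 \<squnion> y\<^sub>2"
  proof -
    have "g \<le> u\<^sub>1 \<squnion> u\<^sub>2"
      using le_sup_minus [of g u\<^sub>1] u(3) by simp
    also have "\<dots> \<le> (r\<^sub>1 \<squnion> p\<^sub>1) \<squnion> (r\<^sub>2 \<squnion> p\<^sub>2)"
      using sup_mono [OF le_sup_minus [of u\<^sub>1 r\<^sub>1] le_sup_minus [of u\<^sub>2 r\<^sub>2]]
      by (simp only: p1(3) p2(3))
    also have "\<dots> = (r\<^sub>1 \<squnion> r\<^sub>2) \<squnion> (p\<^sub>1 \<squnion> p\<^sub>2)"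
      by (simp add: ac_simps)
    also have "\<dots> = y\<^sub>1 \<squnion> y\<^sub>2"
      by (simp add: y\<^sub>1_def y\<^sub>2_def ac_simps flip: s(1))
    finally show ?thesis .
  qed
  \<comment> \<open>Regularization must not lose \<open>p\<^sub>1\<close>, which supplies
    nonzeroness and the bound \<open>h\<^sub>1\<close>. The reason is \<open>g - (u\<^sub>2
    \<squnion> r\<^sub>1) = u\<^sub>1 - r\<^sub>1 = p\<^sub>1\<close>.\<close>
  have py1: "p\<^sub>1 \<le> g - y\<^sub>2"
  proof -
    have "y\<^sub>2 \<le> u\<^sub>2 \<squnion> r\<^sub>1"
      unfolding y\<^sub>2_def using ple(2) sle(2) r2(1) by (meson le_supI le_supI1 le_supI2 order_refl order_trans sup_least)
    then show ?thesis
      using minus_mono [of g g y\<^sub>2 "u\<^sub>2 \<squnion> r\<^sub>1"] u(4) p1(3) by (simp flip: minus_minus_sup)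
  qed
  have py2: "p\<^sub>2 \<le> g - y\<^sub>1"
  proof -
    have "y\<^sub>1 \<le> u\<^sub>1 \<squnion> r\<^sub>2"
      unfolding y\<^sub>1_def using ple(1) sle(1) r1(1) by (meson le_supI le_supI1 le_supI2 order_refl order_trans sup_least)
    then show ?thesis
      using minus_mono [of g g y\<^sub>1 "u\<^sub>1 \<squnion> r\<^sub>2"] u(3) p2(3) by (simp flip: minus_minus_sup)
  qed

  \<comment> \<open>Regularization: a triple difference from \<open>g\<close> collapses to a single
    one, so the two elements become mutual differences in \<open>g\<close>. Each also lies below its
    \<open>y\<close>, hence inherits the avoidance identities.\<close>
  define x\<^sub>1 where "x\<^sub>1 = g - y\<^sub>2"
  define x\<^sub>2 where "x\<^sub>2 = g - x\<^sub>1"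
  have xy1: "x\<^sub>1 \<le> y\<^sub>1"
    using gy by (simp add: x\<^sub>1_def minus_le_iff_le_sup sup_commute)
  have xy2: "x\<^sub>2 \<le> y\<^sub>2"
    using le_sup_minus [of g y\<^sub>2] by (simp add: x\<^sub>2_def x\<^sub>1_def minus_le_iff_le_sup sup_commute)
  have xg: "x\<^sub>1 \<le> g" "x\<^sub>2 \<le> g"
    by (simp_all add: x\<^sub>1_def x\<^sub>2_def minus_le_self)
  have x12: "x\<^sub>1 \<squnion> x\<^sub>2 = g"
    using xg le_sup_minus [of g x\<^sub>1] by (simp add: x\<^sub>2_def order.antisym)
  have gx2: "g - x\<^sub>2 = x\<^sub>1"
  proof (rule order.antisym)
    show "g - x\<^sub>2 \<le> x\<^sub>1"
      using x12 by (simp add: minus_le_iff_le_sup sup_commute)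
    show "x\<^sub>1 \<le> g - x\<^sub>2"
      unfolding x\<^sub>1_def using minus_mono [OF order_refl xy2, of g] by simp
  qed
  have px1: "p\<^sub>1 \<le> x\<^sub>1"
    using py1 by (simp add: x\<^sub>1_def)
  have px2: "p\<^sub>2 \<le> x\<^sub>2"
    using order_trans [OF py2 minus_mono [OF order_refl xy1]] by (simp add: x\<^sub>2_def)
  have nonbot: "x\<^sub>1 \<noteq> \<bottom>" "x\<^sub>2 \<noteq> \<bottom>"
    using px1 px2 p1(1) p2(1) bot.extremum_unique by metis+
  \<comment> \<open>If \<open>x\<close> were in \<open>L\<^sub>0\<close>, irreducibility of
    \<open>g\<close> would give \<open>x' = g\<close>, whence
    \<open>x = g - g = \<bottom>\<close>.\<close>
  have outside: "x \<notin> L\<^sub>0" if x: "g - x = x'" "g - x' = x" "x \<noteq> \<bottom>" "x' \<noteq> \<bottom>" for x x'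
  proof
    assume "x \<in> L\<^sub>0"
    have "\<not> g \<le> x"
      using x(1,4) by (auto simp flip: minus_eq_bot_iff)
    then have "x' = g"
      using diff [OF g \<open>x \<in> L\<^sub>0\<close>] x(1) by simp
    with x(2,3) show False
      by (metis minus_eq_bot_iff order_refl)
  qed
  have gx1: "g - x\<^sub>1 = x\<^sub>2"
    by (simp add: x\<^sub>2_def)
  have out: "x\<^sub>1 \<notin> L\<^sub>0" "x\<^sub>2 \<notin> L\<^sub>0"
    using outside [OF gx1 gx2 nonbot] outside [OF gx2 gx1 nonbot(2,1)] by auto
  have gL: "g \<in> L\<^sub>0"
    using g by (simp add: join_irreducible_def)
  \<comment> \<open>Equality would make \<open>x\<^sub>1\<close> equal to the join \<open>g\<close>,
    a member of \<open>L\<^sub>0\<close>.\<close>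
  have neq: "x\<^sub>1 \<noteq> x\<^sub>2"
    using x12 out gL by auto

  \<comment> \<open>Such an \<open>a\<close> lies below
    \<open>k = h\<^sub>1 \<squnion> h\<^sub>2\<close>, hence below one of the two; failing one bound
    puts it in the corresponding set.\<close>
  have cases: "a \<le> h\<^sub>1 \<or> a \<in> A\<^sub>2" "a \<le> h\<^sub>2 \<or> a \<in> A\<^sub>1" if "join_irreducible L\<^sub>0 a" "a < g" for a
    using that k(3) [of a] join_irreducible_le_sup [OF that(1) h(1,2)] h(3)
    by (auto simp: A\<^sub>1_def A\<^sub>2_def join_irreducible_def)
  have hx: "h\<^sub>1 \<le> x\<^sub>1" "h\<^sub>2 \<le> x\<^sub>2"
    using p1(2) px1 p2(2) px2 by auto
  have ax1: "a - x\<^sub>1 = a" if "a \<in> A\<^sub>2" for a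
    using y1 [OF that] xy1 by (rule minus_eq_self_mono)
  have ax2: "a - x\<^sub>2 = a" if "a \<in> A\<^sub>1" for a
    using y2 [OF that] xy2 by (rule minus_eq_self_mono)
  have bot: "\<bottom> \<in> L\<^sub>0"
    using assms(3) by (simp add: sub_cbs_def)
  have mem: "a - x\<^sub>1 \<in> L\<^sub>0" "a - x\<^sub>2 \<in> L\<^sub>0" if a: "join_irreducible L\<^sub>0 a" "a < g" for a
  proof -
    have "a \<in> L\<^sub>0"
      using a(1) by (simp add: join_irreducible_def)
    moreover have "a - x\<^sub>1 = \<bottom> \<or> a - x\<^sub>1 = a" "a - x\<^sub>2 = \<bottom> \<or> a - x\<^sub>2 = a"
      using cases [OF a] hx ax1 ax2 by (auto simp: minus_eq_bot_iff)
    ultimately show "a - x\<^sub>1 \<in> L\<^sub>0" "a - x\<^sub>2 \<in> L\<^sub>0"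
      using bot by metis+
  qed
  have below: "a < x\<^sub>1 \<longleftrightarrow> a \<le> h\<^sub>1" "a < x\<^sub>2 \<longleftrightarrow> a \<le> h\<^sub>2" if a: "join_irreducible L\<^sub>0 a" for a
  proof -
    have nb: "a \<noteq> \<bottom>" and aL: "a \<in> L\<^sub>0"
      using join_irreducible_nonbot [OF a] a by (auto simp: join_irreducible_def)
    show "a < x\<^sub>1 \<longleftrightarrow> a \<le> h\<^sub>1"
    proof
      \<comment> \<open>Otherwise \<open>a\<close> would be in \<open>A\<^sub>2\<close>, and then
        \<open>a = a - x\<^sub>1 = \<bottom>\<close>. In the converse, strictness holds because
        \<open>x\<^sub>1\<close> is outside \<open>L\<^sub>0\<close>.\<close>
      assume "a < x\<^sub>1"
      then have "a < g" "a - x\<^sub>1 = \<bottom>"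
        using xg by (auto simp: minus_eq_bot_iff)
      then show "a \<le> h\<^sub>1"
        using cases(1) [OF a] ax1 nb by auto
    next
      assume "a \<le> h\<^sub>1"
      then show "a < x\<^sub>1"
        using hx(1) out(1) aL by (auto simp: order_le_less)
    qed
    show "a < x\<^sub>2 \<longleftrightarrow> a \<le> h\<^sub>2"
    proof
      assume "a < x\<^sub>2"
      then have "a < g" "a - x\<^sub>2 = \<bottom>"
        using xg by (auto simp: minus_eq_bot_iff)
      then show "a \<le> h\<^sub>2"
        using cases(2) [OF a] ax2 nb by auto
    next
      assume "a \<le> h\<^sub>2"
      then show "a < x\<^sub>2"
        using hx(2) out(2) aL by (auto simp: order_le_less)
    qed
  qed
  have "second_kind_primitive_couple L\<^sub>0 x\<^sub>1 x\<^sub>2"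
    unfolding second_kind_primitive_couple_def using out neq g gx1 gx2 mem by blast
  moreover have "induces_second_kind_signature L\<^sub>0 x\<^sub>1 x\<^sub>2 h\<^sub>1 h\<^sub>2 g"
    unfolding induces_second_kind_signature_def using x12 below by simp
  ultimately show ?thesis
    by blast
qed

end
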